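(* Let $\mathcal{U}$ be a unital of order $q$ and let $\mathcal{S}$ be a maximal Erdős-Ko-Rado set on $\mathcal{U}$. If $q\geq5$, then either $|\mathcal{S}|=q^{2}$ and $\mathcal{S}$ is a point-pencil, or else $|\mathcal{S}|\leq q^{2}-q+\sqrt[3]{q^{2}}-\frac{2}{3}\sqrt[3]{q}+1$. If $q=4$, then either $|\mathcal{S}|=16=q^{2}$ and $\mathcal{S}$ is a point-pencil, or else $|\mathcal{S}|\leq 13=q^{2}-q+1$. If $q=3$, then either $|\mathcal{S}|=9=q^{2}$ and $\mathcal{S}$ is a point-pencil, or else $|\mathcal{S}|\leq 8$.
   Context: A $2-(v,k,1)$ design, with integers $v>k>1$, consists of a set $\mathcal{P}$ of $v$ points together with a set $\mathcal{B}$ of $k$-subsets of $\mathcal{P}$ (blocks) such that any two distinct points are contained in exactly one block. A unital of order $q$, $q\geq 2$ an integer, is a $2-(q^{3}+1,q+1,1)$ design. An Erdős-Ko-Rado set on a design is a set of pairwise intersecting blocks; it is maximal if it cannot be extended to a larger Erdős-Ko-Rado set of the design. A point-pencil is the set of all blocks through a fixed point. *)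

theory Defs
  imports Complex_Main
begin

definition two_design :: "nat \<Rightarrow> nat \<Rightarrow> 'a set \<Rightarrow> 'a set set \<Rightarrow> bool" where
  "two_design v k P \<B> \<longleftrightarrow>
     1 < k \<and> k < v \<and> finite P \<and> card P = v \<and>
     (\<forall>b\<in>\<B>. b \<subseteq> P \<and> card b = k) \<and>
     (\<forall>x\<in>P. \<forall>y\<in>P. x \<noteq> y \<longrightarrow> (\<exists>!b. b \<in> \<B> \<and> x \<in> b \<and> y \<in> b))"

definition unital :: "nat \<Rightarrow> 'a set \<Rightarrow> 'a set set \<Rightarrow> bool" where
  "unital q P \<B> \<longleftrightarrow> 2 \<le> q \<and> two_design (q ^ 3 + 1) (q + 1) P \<B>"

text \<open>\<open>pairwise\<close> only compares distinct blocks; as blocks are nonempty, each block meets itself anyway.\<close>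

definition ekr_set :: "'a set set \<Rightarrow> 'a set set \<Rightarrow> bool" where
  "ekr_set \<B> S \<longleftrightarrow> S \<subseteq> \<B> \<and> pairwise (\<lambda>b c. b \<inter> c \<noteq> {}) S"

definition maximal_ekr_set :: "'a set set \<Rightarrow> 'a set set \<Rightarrow> bool" where
  "maximal_ekr_set \<B> S \<longleftrightarrow> ekr_set \<B> S \<and> \<not> (\<exists>T. ekr_set \<B> T \<and> S \<subset> T)"

definition point_pencil :: "'a set \<Rightarrow> 'a set set \<Rightarrow> 'a set set \<Rightarrow> bool" where
  "point_pencil P \<B> S \<longleftrightarrow> (\<exists>p\<in>P. S = {b \<in> \<B>. p \<in> b})"

end

theory Submission
  imports Defs
begin

text \<open>Suppose \<open>S\<close> is not a point-pencil, and write \<open>card S = q\<^sup>2 - q + T\<close> and \<open>card (\<Union>S) = q\<^sup>2 + a\<close>.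
  Counting the pairs of points of \<open>\<Union>S\<close> on the blocks through the outside points gives
  \<open>T q (q - 1) \<le> a (a - 1)\<close>, so it suffices to bound \<open>a\<close>. By maximality every point lies off some
  block of \<open>S\<close> and so has degree at most \<open>q + 1\<close> in \<open>S\<close>. If this degree occurs, the blocks of \<open>S\<close> through
  that point cover \<open>\<Union>S\<close>, whence \<open>a = q + 1\<close>. If the largest degree is \<open>q\<close>, counting degree defects
  gives \<open>T (a - 1) \<le> q\<^sup>2 - q - T q + T\<^sup>2\<close>; as \<open>a\<close> must be at least about \<open>q \<surd>T\<close>, this forces
  \<open>T\<close> to be at most about \<open>q powr (2 / 3)\<close>. If all degrees are below \<open>q\<close>, then \<open>T < 0\<close>.\<close>

section \<open>Double counting of incidences between points and blocks\<close>

lemma sum_card_Int: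
  fixes f :: "'a set \<Rightarrow> int"
  assumes "finite A" "finite S"
  shows "(\<Sum>p\<in>A. \<Sum>b | b \<in> S \<and> p \<in> b. f b) = (\<Sum>b\<in>S. int (card (b \<inter> A)) * f b)"
proof -
  have "(\<Sum>p\<in>A. \<Sum>b | b \<in> S \<and> p \<in> b. f b) = (\<Sum>b\<in>S. \<Sum>p | p \<in> A \<and> p \<in> b. f b)"
    by (rule sum.swap_restrict[OF assms])
  also have "\<dots> = (\<Sum>b\<in>S. int (card (b \<inter> A)) * f b)"
    by (rule sum.cong) (auto simp: Int_def conj_commute)
  finally show ?thesis .
qed

lemma sum_blocks_swap:
  fixes g :: "'a \<Rightarrow> int"
  assumes "finite A" "finite S"
  shows "(\<Sum>b\<in>S. \<Sum>p\<in>b \<inter> A. g p) = (\<Sum>p\<in>A. int (card {b \<in> S. p \<in> b}) * g p)"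
proof -
  have "(\<Sum>b\<in>S. \<Sum>p\<in>b \<inter> A. g p) = (\<Sum>b\<in>S. \<Sum>p | p \<in> A \<and> p \<in> b. g p)"
    by (intro sum.cong) auto
  also have "\<dots> = (\<Sum>p\<in>A. \<Sum>b | b \<in> S \<and> p \<in> b. g p)"
    by (rule sum.swap_restrict[OF assms(2,1)])
  finally show ?thesis by simp
qed

section \<open>Designs with blocks of size \<open>q + 1\<close> and one block on any two
  points\<close>

locale steiner_system =
  fixes v q :: nat and P :: "'a set" and \<B> :: "'a set set"
  assumes design: "two_design v (q + 1) P \<B>"
begin

lemma finite_points: "finite P" and card_points: "card P = v" and q_pos: "0 < q"
  using design by (auto simp: two_design_def)

lemma block_subset: "b \<in> \<B> \<Longrightarrow> b \<subseteq> P" and card_block: "b \<in> \<B> \<Longrightarrow> card b = q + 1"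
  using design by (auto simp: two_design_def)

lemma finite_block: "b \<in> \<B> \<Longrightarrow> finite b"
  using block_subset finite_points finite_subset by blast

lemma finite_blocks: "finite \<B>"
  by (rule finite_subset[of _ "Pow P"]) (use block_subset finite_points in auto)

lemma ex_block: "x \<in> P \<Longrightarrow> y \<in> P \<Longrightarrow> x \<noteq> y \<Longrightarrow> \<exists>b\<in>\<B>. x \<in> b \<and> y \<in> b"
  using design unfolding two_design_def by metis

lemma block_unique:
  assumes "b \<in> \<B>" "c \<in> \<B>" "x \<in> b" "y \<in> b" "x \<in> c" "y \<in> c" "x \<noteq> y"
  shows "b = c"
proof -
  have "x \<in> P" "y \<in> P" using assms block_subset by auto
  then have "\<exists>!b. b \<in> \<B> \<and> x \<in> b \<and> y \<in> b"
    using design \<open>x \<noteq> y\<close> unfolding two_design_def by blast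
  with assms show ?thesis by blast
qed

text \<open>Two blocks through \<open>p\<close> share no second point, so their traces on a set
  missing \<open>p\<close> are disjoint.\<close>

lemma sum_card_Int_through:
  assumes "S \<subseteq> \<B>" "p \<notin> X" "X \<subseteq> P"
  shows "(\<Sum>b | b \<in> S \<and> p \<in> b. int (card (b \<inter> X))) = int (card (X \<inter> \<Union>{b \<in> S. p \<in> b}))"
proof -
  let ?C = "{b \<in> S. p \<in> b}"
  have fin: "finite ?C" by (rule finite_subset[OF _ finite_blocks]) (use assms in auto)
  have "int (card (\<Union>b\<in>?C. b \<inter> X)) = (\<Sum>b\<in>?C. int (card (b \<inter> X)))"
    unfolding of_nat_sum[symmetric] of_nat_eq_iff
  proof (rule card_UN_disjoint[OF fin])
    show "\<forall>b\<in>?C. finite (b \<inter> X)" using assms finite_block by auto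
    show "\<forall>b\<in>?C. \<forall>c\<in>?C. b \<noteq> c \<longrightarrow> b \<inter> X \<inter> (c \<inter> X) = {}"
    proof (intro ballI impI)
      fix b c assume h: "b \<in> ?C" "c \<in> ?C" "b \<noteq> c"
      show "b \<inter> X \<inter> (c \<inter> X) = {}"
      proof (rule ccontr)
        assume "b \<inter> X \<inter> (c \<inter> X) \<noteq> {}"
        then obtain y where "y \<in> b" "y \<in> c" "y \<in> X" by auto
        then show False using block_unique[of b c p y] h assms by auto
      qed
    qed
  qed
  moreover have "(\<Union>b\<in>?C. b \<inter> X) = X \<inter> \<Union>?C" by auto
  ultimately show ?thesis by simp
qed

lemma sum_card_Int_point:
  assumes "p \<in> P" "p \<notin> X" "X \<subseteq> P"
  shows "(\<Sum>b | b \<in> \<B> \<and> p \<in> b. int (card (b \<inter> X))) = int (card X)"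
proof -
  have "X \<subseteq> \<Union>{b \<in> \<B>. p \<in> b}"
  proof
    fix x assume "x \<in> X"
    then show "x \<in> \<Union>{b \<in> \<B>. p \<in> b}" using ex_block[of p x] assms by auto
  qed
  then have "X \<inter> \<Union>{b \<in> \<B>. p \<in> b} = X" by auto
  then show ?thesis using sum_card_Int_through[of \<B> p X] assms by simp
qed

text \<open>Away from \<open>p\<close> these blocks are disjoint, with \<open>q\<close> points each.
  The block \<open>b0\<close> guarantees that \<open>p\<close> itself is covered; with no block
  through \<open>p\<close> the union would be empty.\<close>

lemma card_Union_through:
  assumes "S \<subseteq> \<B>" "b0 \<in> S" "p \<in> b0"
  shows "int (card (\<Union>{b \<in> S. p \<in> b})) = 1 + int q * int (card {b \<in> S. p \<in> b})"
proof -
  let ?U = "\<Union>{b \<in> S. p \<in> b}"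
  have "?U \<subseteq> P" using assms block_subset by auto
  then have fin: "finite ?U" using finite_points finite_subset by blast
  have pU: "p \<in> ?U" using assms by auto
  have "(P - {p}) \<inter> ?U = ?U - {p}" using \<open>?U \<subseteq> P\<close> by auto
  moreover have "card (?U - {p}) = card ?U - 1" using pU fin by simp
  moreover have "card ?U > 0" using pU fin by (auto simp: card_gt_0_iff)
  ultimately have "int (card ?U) - 1 = (\<Sum>b | b \<in> S \<and> p \<in> b. int (card (b \<inter> (P - {p}))))"
    using sum_card_Int_through[of S p "P - {p}"] assms by simp
  also have "\<dots> = (\<Sum>b | b \<in> S \<and> p \<in> b. int q)"
  proof (rule sum.cong)
    fix b assume "b \<in> {b \<in> S. p \<in> b}"
    then have "b \<in> \<B>" "p \<in> b" using assms by auto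
    moreover then have "b \<inter> (P - {p}) = b - {p}" using block_subset by auto
    ultimately show "int (card (b \<inter> (P - {p}))) = int q" using card_block by simp
  qed simp
  finally show ?thesis by (simp add: mult.commute)
qed

lemma replication:
  assumes "p \<in> P"
  shows "int q * int (card {b \<in> \<B>. p \<in> b}) = int v - 1"
proof -
  have "v > 1" using design q_pos by (auto simp: two_design_def)
  have "int (card (P - {p})) = int v - 1"
    using assms card_points finite_points \<open>v > 1\<close> by simp
  then have "int v - 1 = (\<Sum>b | b \<in> \<B> \<and> p \<in> b. int (card (b \<inter> (P - {p}))))"
    using sum_card_Int_point[of p "P - {p}"] assms by simp
  also have "\<dots> = (\<Sum>b | b \<in> \<B> \<and> p \<in> b. int q)"
  proof (rule sum.cong)
    fix b assume "b \<in> {b \<in> \<B>. p \<in> b}"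
    then have "b \<in> \<B>" "p \<in> b" by auto
    moreover then have "b \<inter> (P - {p}) = b - {p}" using block_subset by auto
    ultimately show "int (card (b \<inter> (P - {p}))) = int q" using card_block by simp
  qed simp
  finally show ?thesis by simp
qed

text \<open>Ordered pairs of distinct points of \<open>W\<close> are sorted by the unique block
  joining them.\<close>

lemma sum_card_Int_pairs:
  assumes "W \<subseteq> P"
  shows "(\<Sum>b\<in>\<B>. int (card (b \<inter> W)) * (int (card (b \<inter> W)) - 1)) = int (card W) * (int (card W) - 1)"
proof -
  have fW: "finite W" using assms finite_points finite_subset by blast
  have cardm: "int (card (A - {p})) = int (card A) - 1" if "finite A" "p \<in> A" for A :: "'a set" and p
    using that card_Suc_Diff1[OF that] by simp
  have "(\<Sum>p\<in>W. \<Sum>b | b \<in> \<B> \<and> p \<in> b. int (card (b \<inter> W)) - 1) = (\<Sum>p\<in>W. int (card W) - 1)"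
  proof (rule sum.cong)
    fix p assume p: "p \<in> W"
    have "(\<Sum>b | b \<in> \<B> \<and> p \<in> b. int (card (b \<inter> W)) - 1) =
        (\<Sum>b | b \<in> \<B> \<and> p \<in> b. int (card (b \<inter> (W - {p}))))"
    proof (rule sum.cong)
      fix b assume "b \<in> {b \<in> \<B>. p \<in> b}"
      moreover have "b \<inter> (W - {p}) = (b \<inter> W) - {p}" by auto
      ultimately show "int (card (b \<inter> W)) - 1 = int (card (b \<inter> (W - {p})))"
        using cardm[of "b \<inter> W" p] p fW by simp
    qed simp
    also have "\<dots> = int (card (W - {p}))"
      using sum_card_Int_point[of p "W - {p}"] p assms by auto
    finally show "(\<Sum>b | b \<in> \<B> \<and> p \<in> b. int (card (b \<inter> W)) - 1) = int (card W) - 1"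
      using cardm[OF fW p] by simp
  qed simp
  then show ?thesis using sum_card_Int[OF fW finite_blocks] by simp
qed

text \<open>Each point outside \<open>W\<close> sees \<open>W\<close> through \<open>r\<close> blocks, so at least \<open>card W - r\<close>
  pairs of \<open>W\<close> lie on these blocks; none of these pairs is covered by \<open>S\<close>.\<close>

lemma card_Union_bound:
  assumes S: "S \<subseteq> \<B>" and W: "W = \<Union>S"
    and r: "\<And>p. p \<in> P \<Longrightarrow> int (card {b \<in> \<B>. p \<in> b}) = r"
  shows "2 * (int (card W) - r) * (int v - int (card W))
    \<le> (int q - 1) * (int (card W) * (int (card W) - 1) - int (card S) * (int q * (int q + 1)))"
proof -
  let ?n = "\<lambda>b. int (card (b \<inter> W))"
  have WP: "W \<subseteq> P" using S W block_subset by auto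
  have fW: "finite W" using WP finite_points finite_subset by blast
  have fS: "finite S" using S finite_blocks finite_subset by blast
  have cPW: "int (card (P - W)) = int v - int (card W)"
    using card_Diff_subset[OF fW WP] card_mono[OF finite_points WP] card_points by simp
  have sat: "?n b = int q + 1" if "b \<in> S" for b
  proof -
    have "b \<inter> W = b" using that W by auto
    then show ?thesis using card_block that S by auto
  qed
  have "2 * (int (card W) - r) * (int v - int (card W)) = (\<Sum>p\<in>P - W. 2 * (int (card W) - r))"
    using cPW by simp
  also have "\<dots> \<le> (\<Sum>p\<in>P - W. \<Sum>b | b \<in> \<B> \<and> p \<in> b. ?n b * (?n b - 1))"
  proof (rule sum_mono)
    fix p assume p: "p \<in> P - W"
    have "2 * (int (card W) - r) = (\<Sum>b | b \<in> \<B> \<and> p \<in> b. 2 * (?n b - 1))"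
      using sum_card_Int_point[of p W] p WP r[of p]
      by (simp add: sum_distrib_left[symmetric] sum_subtractf)
    \<comment> \<open>The difference of the summands is \<open>(n - 1) * (n - 2)\<close>,
      nonnegative for every integer \<open>n\<close>.\<close>
    also have "\<dots> \<le> (\<Sum>b | b \<in> \<B> \<and> p \<in> b. ?n b * (?n b - 1))"
    proof (rule sum_mono)
      fix b
      consider "?n b = 0" | "?n b = 1" | "?n b \<ge> 2" by linarith
      then show "2 * (?n b - 1) \<le> ?n b * (?n b - 1)"
        by cases (simp, simp, rule mult_right_mono, simp_all)
    qed
    finally show "2 * (int (card W) - r) \<le> (\<Sum>b | b \<in> \<B> \<and> p \<in> b. ?n b * (?n b - 1))" .
  qed
  also have "\<dots> = (\<Sum>b\<in>\<B>. int (card (b \<inter> (P - W))) * (?n b * (?n b - 1)))"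
    by (rule sum_card_Int) (use finite_points finite_blocks in auto)
  also have "\<dots> = (\<Sum>b\<in>\<B>. (int q + 1 - ?n b) * (?n b * (?n b - 1)))"
  proof (rule sum.cong)
    fix b assume b: "b \<in> \<B>"
    have "b \<inter> (P - W) = b - b \<inter> W" using block_subset[OF b] by auto
    moreover have "int (card (b - b \<inter> W)) = int (card b) - ?n b"
      using card_Diff_subset[of "b \<inter> W" b] card_mono[of b "b \<inter> W"] finite_block[OF b] by simp
    ultimately show "int (card (b \<inter> (P - W))) * (?n b * (?n b - 1)) = (int q + 1 - ?n b) * (?n b * (?n b - 1))"
      using card_block[OF b] by simp
  qed simp
  \<comment> \<open>Blocks of \<open>S\<close> lie inside \<open>W\<close>, so their factor
    \<open>q + 1 - n\<close> vanishes.\<close>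
  also have "\<dots> = (\<Sum>b\<in>\<B> - S. (int q + 1 - ?n b) * (?n b * (?n b - 1)))"
    by (rule sum.mono_neutral_right[OF finite_blocks]) (use sat in auto)
  \<comment> \<open>A block with two points in \<open>W\<close> has at most \<open>q - 1\<close>
    points outside; blocks with fewer contribute 0.\<close>
  also have "\<dots> \<le> (\<Sum>b\<in>\<B> - S. (int q - 1) * (?n b * (?n b - 1)))"
  proof (rule sum_mono)
    fix b
    consider "?n b = 0" | "?n b = 1" | "?n b \<ge> 2" by linarith
    then show "(int q + 1 - ?n b) * (?n b * (?n b - 1)) \<le> (int q - 1) * (?n b * (?n b - 1))"
      by cases (auto intro!: mult_right_mono)
  qed
  also have "\<dots> = (int q - 1) * ((\<Sum>b\<in>\<B>. ?n b * (?n b - 1)) - (\<Sum>b\<in>S. ?n b * (?n b - 1)))"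
    by (simp add: sum_distrib_left[symmetric] sum_diff[OF finite_blocks S])
  also have "(\<Sum>b\<in>S. ?n b * (?n b - 1)) = int (card S) * (int q * (int q + 1))"
    using sat by simp
  also have "(\<Sum>b\<in>\<B>. ?n b * (?n b - 1)) = int (card W) * (int (card W) - 1)"
    by (rule sum_card_Int_pairs[OF WP])
  finally show ?thesis .
qed

end

section \<open>Point degrees in an Erdos-Ko-Rado set\<close>

locale ekr = steiner_system +
  fixes S :: "'a set set"
  assumes ekr: "ekr_set \<B> S"
begin

abbreviation deg :: "'a \<Rightarrow> int" where
  "deg p \<equiv> int (card {b \<in> S. p \<in> b})"

lemma S_subset: "S \<subseteq> \<B>" and finite_S: "finite S"
  using ekr finite_blocks finite_subset by (auto simp: ekr_set_def)

lemma card_Int_eq_1: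
  assumes "b \<in> S" "c \<in> S" "b \<noteq> c"
  shows "card (b \<inter> c) = 1"
proof -
  have "b \<inter> c \<noteq> {}" using ekr assms by (auto simp: ekr_set_def pairwise_def)
  then obtain x where x: "x \<in> b \<inter> c" by auto
  have "b \<inter> c = {x}"
    using block_unique[of b c x] x assms S_subset by auto
  then show ?thesis by simp
qed

text \<open>Every other block of \<open>S\<close> meets \<open>L\<close> once, while
  \<open>L\<close> itself is counted \<open>q + 1\<close> times.\<close>

lemma sum_deg_block:
  assumes L: "L \<in> S"
  shows "(\<Sum>p\<in>L. deg p) = int (card S) + int q"
proof -
  have fL: "finite L" and cL: "card L = q + 1" using L S_subset finite_block card_block by auto
  have "(\<Sum>p\<in>L. deg p) = (\<Sum>p\<in>L. \<Sum>b | b \<in> S \<and> p \<in> b. 1)" by simp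
  also have "\<dots> = (\<Sum>b\<in>S. int (card (b \<inter> L)) * 1)" by (rule sum_card_Int[OF fL finite_S])
  also have "\<dots> = int (card (L \<inter> L)) + (\<Sum>b\<in>S - {L}. int (card (b \<inter> L)))"
    using sum.remove[OF finite_S L, of "\<lambda>b. int (card (b \<inter> L))"] by simp
  also have "(\<Sum>b\<in>S - {L}. int (card (b \<inter> L))) = (\<Sum>b\<in>S - {L}. 1)"
    by (rule sum.cong) (use card_Int_eq_1 L in auto)
  also have "\<dots> = int (card S) - 1" using card_Suc_Diff1[OF finite_S L] by simp
  finally show ?thesis using cL by simp
qed

text \<open>Each block of \<open>S\<close> through \<open>p\<close> meets \<open>L\<close> in one
  point, and these points differ because two such blocks share only \<open>p\<close>.\<close>

lemma card_Int_Union_through: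
  assumes L: "L \<in> S" "p \<notin> L"
  shows "int (card (L \<inter> \<Union>{b \<in> S. p \<in> b})) = deg p"
proof -
  have "L \<subseteq> P" using L S_subset block_subset by auto
  then have "int (card (L \<inter> \<Union>{b \<in> S. p \<in> b})) = (\<Sum>b | b \<in> S \<and> p \<in> b. int (card (b \<inter> L)))"
    using sum_card_Int_through[OF S_subset L(2)] by simp
  also have "\<dots> = (\<Sum>b | b \<in> S \<and> p \<in> b. 1)"
    by (rule sum.cong) (use card_Int_eq_1 L in auto)
  finally show ?thesis by simp
qed

lemma deg_le:
  assumes L: "L \<in> S" "p \<notin> L"
  shows "deg p \<le> int q + 1"
proof -
  have "card (L \<inter> \<Union>{b \<in> S. p \<in> b}) \<le> card L"
    using L S_subset finite_block by (intro card_mono) auto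
  then show ?thesis using card_Int_Union_through[OF L] card_block L S_subset by auto
qed

text \<open>Sums the degrees along a single block of \<open>S\<close>. For \<open>t = q - 1\<close>
  this yields \<open>card S \<le> q^2 - q - 1\<close>.\<close>

lemma card_S_le_of_deg_le:
  assumes "S \<noteq> {}" "\<And>p. deg p \<le> t"
  shows "int (card S) + int q \<le> (int q + 1) * t"
proof -
  obtain L where L: "L \<in> S" using assms by auto
  have "(\<Sum>p\<in>L. deg p) \<le> (\<Sum>p\<in>L. t)" by (rule sum_mono) (rule assms)
  then show ?thesis using sum_deg_block[OF L] card_block[of L] L S_subset by (auto simp: add.commute)
qed

text \<open>A block of \<open>S\<close> missing \<open>p\<close> meets the \<open>q + 1\<close>
  blocks through \<open>p\<close> in distinct points, so it is contained in their union.\<close>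

lemma card_Union_of_deg_eq:
  assumes p: "deg p = int q + 1"
  shows "int (card (\<Union>S)) = int q ^ 2 + int q + 1"
proof -
  let ?U = "\<Union>{b \<in> S. p \<in> b}"
  have "{b \<in> S. p \<in> b} \<noteq> {}"
  proof
    assume "{b \<in> S. p \<in> b} = {}"
    then have "deg p = 0" by (simp only: card.empty)
    then show False using p by linarith
  qed
  then obtain b0 where b0: "b0 \<in> S" "p \<in> b0" by auto
  have "L \<subseteq> ?U" if L: "L \<in> S" for L
  proof (cases "p \<in> L")
    case False
    have "card (L \<inter> ?U) = card L"
      using card_Int_Union_through[OF L False] p card_block[of L] L S_subset by auto
    moreover have "finite L" using L S_subset finite_block by auto
    ultimately have "L \<inter> ?U = L" by (intro card_subset_eq) auto
    then show ?thesis by auto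
  qed (use L in auto)
  then have "\<Union>S = ?U" by auto
  then show ?thesis using card_Union_through[OF S_subset b0] p by (simp add: power2_eq_square algebra_simps)
qed

text \<open>With \<open>d y = q - deg y\<close>, every block of \<open>S\<close> has total defect \<open>\<delta> = q\<^sup>2 - card S = q - T\<close>.
  Summing the defects over the \<open>q\<close> blocks through \<open>p\<close>, which cover \<open>U\<close>, and over all of \<open>S\<close>,
  leaves little defect for the set \<open>E\<close> of the other points, each of which has degree at least \<open>T\<close>.\<close>

lemma card_Union_of_deg_eq_pred:
  assumes p: "deg p = int q" and le: "\<And>x. deg x \<le> int q"
  defines "T \<equiv> int (card S) - (int q ^ 2 - int q)"
    and "e \<equiv> int (card (\<Union>S)) - int q ^ 2 - 1"
  shows "T * e \<le> int q ^ 2 - int q - T * int q + T ^ 2" and "0 \<le> e" and "T \<le> int q"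
proof -
  let ?U = "\<Union>{b \<in> S. p \<in> b}" and ?W = "\<Union>S"
  define E where "E = ?W - ?U"
  define d where "d y = int q - deg y" for y
  define \<delta> where "\<delta> = int q - T"
  have "{b \<in> S. p \<in> b} \<noteq> {}" using p q_pos by (metis card.empty of_nat_0 of_nat_eq_iff less_irrefl)
  then obtain b0 where b0: "b0 \<in> S" "p \<in> b0" by auto
  have WP: "?W \<subseteq> P" using S_subset block_subset by auto
  have fW: "finite ?W" using WP finite_points finite_subset by blast
  have UW: "?U \<subseteq> ?W" by auto
  have fU: "finite ?U" and fE: "finite E" using fW UW finite_subset E_def by auto
  have d0: "0 \<le> d y" for y using le[of y] by (simp add: d_def)
  have blk: "(\<Sum>y\<in>L. d y) = \<delta>" if "L \<in> S" for L
    using sum_deg_block[OF that] card_block[of L] that S_subset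
    by (auto simp: d_def \<delta>_def T_def sum_subtractf power2_eq_square algebra_simps)
  \<comment> \<open>One of several nonnegative defects with sum \<delta>; equivalently
    \<open>T \<le> deg y\<close>.\<close>
  have d_le: "d y \<le> \<delta>" if y: "y \<in> ?W" for y
  proof -
    obtain L where L: "L \<in> S" "y \<in> L" using y by auto
    then have "finite L" using S_subset finite_block by auto
    then have "d y \<le> (\<Sum>y\<in>L. d y)" using L d0 by (intro member_le_sum) auto
    then show ?thesis using blk L by simp
  qed
  have cU: "int (card ?U) = int q ^ 2 + 1"
    using card_Union_through[OF S_subset b0] p by (simp add: power2_eq_square)
  have "int (card ?W) = int (card ?U) + int (card E)"
    using card_Diff_subset[OF fU UW] card_mono[OF fW UW] by (simp add: E_def)
  then have e: "e = int (card E)" using cU by (simp add: e_def)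
  show "0 \<le> e" using e by simp
  have "0 \<le> \<delta>" using d_le[of p] d0[of p] b0 by fastforce
  then show "T \<le> int q" by (simp add: \<delta>_def)
  \<comment> \<open>The point \<open>p\<close> has defect 0, and every other point of
    \<open>U\<close> lies on exactly one of the \<open>q\<close> blocks through
    \<open>p\<close>.\<close>
  have sumU: "(\<Sum>y\<in>?U. d y) = int q * \<delta>"
  proof -
    have dp: "d p = 0" using p by (simp add: d_def)
    have disj: "(\<Sum>y\<in>?U - {p}. d y) = (\<Sum>b | b \<in> S \<and> p \<in> b. \<Sum>y\<in>b - {p}. d y)"
    proof -
      have "?U - {p} = (\<Union>b\<in>{b \<in> S. p \<in> b}. b - {p})" by auto
      moreover have "(\<Sum>y\<in>(\<Union>b\<in>{b \<in> S. p \<in> b}. b - {p}). d y) = (\<Sum>b | b \<in> S \<and> p \<in> b. \<Sum>y\<in>b - {p}. d y)"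
      proof (rule sum.UNION_disjoint)
        show "finite {b \<in> S. p \<in> b}" using finite_S by simp
        show "\<forall>b\<in>{b \<in> S. p \<in> b}. finite (b - {p})" using S_subset finite_block by auto
        show "\<forall>b\<in>{b \<in> S. p \<in> b}. \<forall>c\<in>{b \<in> S. p \<in> b}. b \<noteq> c \<longrightarrow> (b - {p}) \<inter> (c - {p}) = {}"
          using block_unique[of _ _ p] S_subset by blast
      qed
      ultimately show ?thesis by simp
    qed
    have "(\<Sum>y\<in>?U. d y) = (\<Sum>y\<in>?U - {p}. d y)"
      by (rule sum.mono_neutral_right[OF fU]) (use dp in auto)
    also have "\<dots> = (\<Sum>b | b \<in> S \<and> p \<in> b. \<delta>)"
      unfolding disj
    proof (rule sum.cong)
      fix b assume "b \<in> {b \<in> S. p \<in> b}"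
      then have b: "b \<in> S" "finite b" using S_subset finite_block by auto
      have "(\<Sum>y\<in>b - {p}. d y) = (\<Sum>y\<in>b. d y)"
        by (rule sum.mono_neutral_left[OF b(2)]) (use dp in auto)
      then show "(\<Sum>y\<in>b - {p}. d y) = \<delta>" using blk b by simp
    qed simp
    finally show ?thesis using p by simp
  qed
  \<comment> \<open>Adding the defect \<delta> of every block of \<open>S\<close> counts the point
    \<open>y\<close> exactly \<open>deg y\<close> times.\<close>
  have sumS: "(\<Sum>y\<in>?U. deg y * d y) + (\<Sum>y\<in>E. deg y * d y) = int (card S) * \<delta>"
  proof -
    have "(\<Sum>y\<in>?U. deg y * d y) + (\<Sum>y\<in>E. deg y * d y) = (\<Sum>y\<in>?W. deg y * d y)"
      using sum.subset_diff[OF UW fW, of "\<lambda>y. deg y * d y"] by (simp add: E_def)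
    also have "\<dots> = (\<Sum>b\<in>S. \<Sum>y\<in>b \<inter> ?W. d y)" by (rule sum_blocks_swap[symmetric, OF fW finite_S])
    also have "\<dots> = (\<Sum>b\<in>S. \<delta>)"
    proof (rule sum.cong)
      fix b assume b: "b \<in> S"
      then have "b \<inter> ?W = b" by auto
      then show "(\<Sum>y\<in>b \<inter> ?W. d y) = \<delta>" using blk[OF b] by simp
    qed simp
    finally show ?thesis by simp
  qed
  have lowU: "T * (int q * \<delta>) \<le> (\<Sum>y\<in>?U. deg y * d y)"
  proof -
    have "T * (int q * \<delta>) = (\<Sum>y\<in>?U. T * d y)" by (simp only: sum_distrib_left[symmetric] sumU)
    also have "\<dots> \<le> (\<Sum>y\<in>?U. deg y * d y)"
    proof (rule sum_mono)
      fix y assume "y \<in> ?U"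
      then have "d y \<le> \<delta>" using d_le UW by blast
      then have "T \<le> deg y" by (simp add: d_def \<delta>_def)
      then show "T * d y \<le> deg y * d y" using d0 by (rule mult_right_mono)
    qed
    finally show ?thesis .
  qed
  have lowE: "T * (\<Sum>y\<in>E. d y) \<le> (\<Sum>y\<in>E. deg y * d y)"
    unfolding sum_distrib_left
  proof (rule sum_mono)
    fix y assume "y \<in> E"
    then have "d y \<le> \<delta>" using d_le by (auto simp: E_def)
    then have "T \<le> deg y" by (simp add: d_def \<delta>_def)
    then show "T * d y \<le> deg y * d y" using d0 by (rule mult_right_mono)
  qed
  \<comment> \<open>The \<open>q\<close> blocks through \<open>p\<close> miss \<open>E\<close>; any
    other block of \<open>S\<close> has \<open>q\<close> of its \<open>q + 1\<close> points in
    \<open>U\<close>, hence exactly one in \<open>E\<close>.\<close>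
  have degE: "(\<Sum>y\<in>E. deg y) = int (card S) - int q"
  proof -
    have "(\<Sum>y\<in>E. deg y) = (\<Sum>y\<in>E. \<Sum>b | b \<in> S \<and> y \<in> b. 1)" by simp
    also have "\<dots> = (\<Sum>b\<in>S. int (card (b \<inter> E)) * 1)" by (rule sum_card_Int[OF fE finite_S])
    also have "\<dots> = (\<Sum>b\<in>S. 1 - (if p \<in> b then 1 else 0))"
    proof (rule sum.cong)
      fix b assume b: "b \<in> S"
      have fb: "finite b" "card b = q + 1" using b S_subset finite_block card_block by auto
      show "int (card (b \<inter> E)) * 1 = 1 - (if p \<in> b then 1 else 0)"
      proof (cases "p \<in> b")
        case True
        then have "b \<inter> E = {}" using b by (auto simp: E_def)
        then show ?thesis using True by simp
      next
        case False
        have "b \<inter> E = b - b \<inter> ?U" using b by (auto simp: E_def)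
        moreover have "int (card (b - b \<inter> ?U)) = int (card b) - int (card (b \<inter> ?U))"
          using card_Diff_subset[of "b \<inter> ?U" b] card_mono[of b "b \<inter> ?U"] fb by simp
        ultimately show ?thesis using card_Int_Union_through[OF b False] fb p False by simp
      qed
    qed simp
    also have "\<dots> = int (card S) - (\<Sum>b\<in>S. if p \<in> b then 1 else 0)" by (simp add: sum_subtractf)
    also have "(\<Sum>b\<in>S. if p \<in> b then 1 else (0::int)) = deg p"
      using sum.inter_filter[OF finite_S, of "\<lambda>_. 1::int" "\<lambda>b. p \<in> b"] by simp
    finally show ?thesis using p by simp
  qed
  have "(\<Sum>y\<in>E. d y) = int q * e - (int (card S) - int q)"
    using degE e by (simp add: d_def sum_subtractf)
  then have "T * (int q * e - (int (card S) - int q)) + T * (int q * \<delta>) \<le> int (card S) * \<delta>"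
    using lowE lowU sumS by simp
  moreover have "int (card S) = int q ^ 2 - int q + T" by (simp add: T_def)
  \<comment> \<open>After substituting \<open>card S\<close> and \<delta>, all terms without a
    factor \<open>q\<close> cancel.\<close>
  ultimately have "int q * (T * e) \<le> int q * (int q ^ 2 - int q - T * int q + T ^ 2)"
    by (simp add: \<delta>_def power2_eq_square algebra_simps)
  then show "T * e \<le> int q ^ 2 - int q - T * int q + T ^ 2"
    using q_pos by simp
qed

end

section \<open>Specialisation to unitals\<close>

lemma card_point_pencil:
  assumes "unital q P \<B>" "p \<in> P"
  shows "card {b \<in> \<B>. p \<in> b} = q ^ 2"
proof -
  interpret steiner_system "q ^ 3 + 1" q P \<B>
    using assms by unfold_locales (simp add: unital_def)
  have "int q * int (card {b \<in> \<B>. p \<in> b}) = int q * int (q ^ 2)"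
    using replication[OF assms(2)] by (simp add: power2_eq_square power3_eq_cube)
  then have "int (card {b \<in> \<B>. p \<in> b}) = int (q ^ 2)"
    using q_pos by (metis mult_left_cancel of_nat_0_eq_iff less_irrefl)
  then show ?thesis using of_nat_eq_iff by blast
qed

lemma unital_card_Union_bound:
  fixes a T :: int
  assumes U: "unital q P \<B>" and S: "S \<subseteq> \<B>"
  defines "T \<equiv> int (card S) - (int q ^ 2 - int q)"
    and "a \<equiv> int (card (\<Union>S)) - int q ^ 2"
  shows "T * (int q * (int q - 1)) \<le> a * (a - 1)"
proof -
  interpret steiner_system "q ^ 3 + 1" q P \<B>
    using U by unfold_locales (simp add: unital_def)
  define Q where "Q = int q"
  have w: "int (card (\<Union>S)) = Q ^ 2 + a" and s: "int (card S) = T + Q ^ 2 - Q"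
    by (simp_all add: a_def T_def Q_def)
  have "2 * (int (card (\<Union>S)) - int q ^ 2) * (int (q ^ 3 + 1) - int (card (\<Union>S)))
    \<le> (int q - 1) * (int (card (\<Union>S)) * (int (card (\<Union>S)) - 1) - int (card S) * (int q * (int q + 1)))"
    by (rule card_Union_bound[OF S refl]) (simp add: card_point_pencil[OF U])
  then have "2 * a * (Q ^ 3 + 1 - (Q ^ 2 + a))
    \<le> (Q - 1) * ((Q ^ 2 + a) * (Q ^ 2 + a - 1) - (T + Q ^ 2 - Q) * (Q * (Q + 1)))"
    unfolding w s by (simp add: Q_def add.commute)
  \<comment> \<open>The terms free of both \<open>a\<close> and \<open>T\<close> cancel, and what
    remains is divisible by \<open>Q + 1\<close>.\<close>
  then have "(Q + 1) * (T * (Q * (Q - 1))) \<le> (Q + 1) * (a * (a - 1))"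
    by (simp add: algebra_simps power2_eq_square power3_eq_cube)
  then show ?thesis by (simp add: Q_def)
qed

text \<open>If all blocks of \<open>S\<close> passed through \<open>p\<close>, then \<open>S\<close>
  would lie in the pencil of \<open>p\<close>, itself an Erdos-Ko-Rado set, and maximality would
  force equality.\<close>

lemma not_pencil_avoiding_block:
  assumes "maximal_ekr_set \<B> S" "\<not> point_pencil P \<B> S" "p \<in> P"
  obtains L where "L \<in> S" "p \<notin> L"
proof -
  have "\<not> (\<forall>L\<in>S. p \<in> L)"
  proof
    assume all: "\<forall>L\<in>S. p \<in> L"
    let ?T = "{b \<in> \<B>. p \<in> b}"
    have "S \<subseteq> ?T" using all assms(1) by (auto simp: maximal_ekr_set_def ekr_set_def)
    moreover have "ekr_set \<B> ?T" by (auto simp: ekr_set_def pairwise_def)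
    ultimately have "S = ?T" using assms(1) by (auto simp: maximal_ekr_set_def)
    then show False using assms(2,3) by (auto simp: point_pencil_def)
  qed
  then show ?thesis using that by blast
qed

text \<open>The alternatives follow the largest degree: below \<open>q\<close> (or \<open>S\<close>
  empty), equal to \<open>q + 1\<close>, and equal to \<open>q\<close>. In the last,
  \<open>e = card (\<Union>S) - q^2 - 1\<close>.\<close>

lemma unital_ekr_excess:
  fixes T :: int
  assumes U: "unital q P \<B>" and M: "maximal_ekr_set \<B> S" and np: "\<not> point_pencil P \<B> S"
  defines "T \<equiv> int (card S) - (int q ^ 2 - int q)"
  shows "T \<le> -1 \<or> T * (int q * (int q - 1)) \<le> int q * (int q + 1) \<or>
    T \<le> int q \<and> (\<exists>e\<ge>0. T * e \<le> int q ^ 2 - int q - T * int q + T ^ 2 \<and>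
       T * (int q * (int q - 1)) \<le> e * (e + 1))"
proof -
  interpret ekr "q ^ 3 + 1" q P \<B> S
    using U M by unfold_locales (simp_all add: unital_def maximal_ekr_set_def)
  have q2: "2 \<le> q" using U by (simp add: unital_def)
  \<comment> \<open>Needed for every element of the type, since the degree bounds used below range
    over all of it; outside \<open>P\<close> the degree is 0.\<close>
  have deg_le': "deg p \<le> int q + 1" for p
  proof (cases "p \<in> P")
    case True
    then show ?thesis using not_pencil_avoiding_block[OF M np] deg_le by metis
  next
    case False
    then have "{b \<in> S. p \<in> b} = {}" using S_subset block_subset by auto
    then have "deg p = 0" by (simp only: card.empty)
    then show ?thesis by linarith
  qed
  have bound: "T * (int q * (int q - 1)) \<le> (int (card (\<Union>S)) - int q ^ 2) * (int (card (\<Union>S)) - int q ^ 2 - 1)"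
    unfolding T_def by (rule unital_card_Union_bound[OF U S_subset])
  consider (empty) "S = {}" | (small) "S \<noteq> {}" "\<And>p. deg p \<le> int q - 1"
    | (top) p where "deg p = int q + 1" | (mid) p where "deg p = int q" "\<And>x. deg x \<le> int q"
  proof (cases "\<exists>p. deg p = int q + 1")
    case False
    then have le: "deg x \<le> int q" for x using deg_le'[of x] by (metis zle_add1_eq_le order_le_less)
    show ?thesis
    proof (cases "\<exists>p. deg p = int q")
      case False
      then have "deg x \<le> int q - 1" for x using le[of x] by (metis zle_diff1_eq order_le_less)
      then show ?thesis using that by blast
    qed (use le that in blast)
  qed (use that in blast)
  then show ?thesis
  proof cases
    case empty
    have "int q * 2 \<le> int q * int q" using q2 by (intro mult_left_mono) auto
    then have "T \<le> - int q" using empty by (simp add: T_def power2_eq_square)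
    then show ?thesis using q2 by linarith
  next
    case small
    then have "int (card S) + int q \<le> (int q + 1) * (int q - 1)" by (rule card_S_le_of_deg_le)
    then show ?thesis by (simp add: T_def power2_eq_square algebra_simps)
  next
    case top
    then show ?thesis using bound card_Union_of_deg_eq by (simp add: algebra_simps)
  next
    case mid
    define e where "e = int (card (\<Union>S)) - int q ^ 2 - 1"
    have "T * (int q * (int q - 1)) \<le> e * (e + 1)"
      using bound by (simp add: e_def mult.commute)
    then show ?thesis
      using card_Union_of_deg_eq_pred[OF mid, folded T_def e_def] by blast
  qed
qed

section \<open>The real inequality behind the cube-root bound\<close>

text \<open>As \<open>X / T + T\<close> is convex in \<open>T\<close>, the bound on \<open>e\<close> need only be examined at
  \<open>T = B\<close> and \<open>T = q\<close>. At \<open>T = B\<close> what remains is the positivity for \<open>c \<ge> 3 / 2\<close> of a polynomial in \<open>c\<close>,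
  whose coefficients in \<open>c - 3 / 2\<close> are all positive.\<close>

lemma excess_le_root_bound:
  fixes c q T e B :: real
  assumes c: "3 / 2 \<le> c" and q: "q = c ^ 3" and B: "B = c ^ 2 - 2 / 3 * c + 1"
    and T: "T \<le> q" and e: "0 \<le> e" "T * e \<le> q ^ 2 - q - T * q + T ^ 2" "T * (q * (q - 1)) \<le> e * (e + 1)"
  shows "T \<le> B"
proof (rule ccontr)
  assume "\<not> T \<le> B"
  then have TB: "B < T" by simp
  define X where "X = q * (q - 1)"
  have "0 \<le> (c - 3 / 2) * c" using c by (intro mult_nonneg_nonneg) auto
  then have B1: "1 < B" using c by (simp add: B power2_eq_square algebra_simps)
  then have q1: "1 < q" using TB T by simp
  then have X0: "0 < X" by (simp add: X_def)
  have "X < T * X" using X0 TB B1 by simp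
  then have "X < e * (e + 1)" using e(3) by (simp add: X_def)
  \<comment> \<open>At \<open>e = q - 1\<close> the product \<open>e * (e + 1)\<close> is only
    \<open>X\<close>.\<close>
  have eq: "q - 1 < e"
  proof (rule ccontr)
    assume "\<not> q - 1 < e"
    then have "e * (e + 1) \<le> (q - 1) * q" using e(1) by (intro mult_mono) auto
    then show False using \<open>X < e * (e + 1)\<close> by (simp add: X_def mult.commute)
  qed
  have "T * (q - 1) < T * e" using eq TB B1 by simp
  then have "0 < (q - T) * (q - T - 1)" using e(2) by (simp add: power2_eq_square algebra_simps)
  then have "T < q - 1" using T by (simp add: zero_less_mult_iff)
  \<comment> \<open>The upper bound on \<open>T * e\<close>, evaluated at
    \<open>T = B\<close>.\<close>
  define g where "g = X - (q - B) * B"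
  have "T * B \<le> (q - 1) * q" using \<open>T < q - 1\<close> TB T B1 by (intro mult_mono) auto
  \<comment> \<open>This product is exactly \<open>T * g\<close> minus \<open>B\<close> times the
    upper bound on \<open>T * e\<close>; its sign thus transfers that bound from \<open>T\<close> to
    \<open>B\<close>.\<close>
  then have "0 \<le> (T - B) * (X - T * B)" using TB by (intro mult_nonneg_nonneg) (auto simp: X_def mult.commute)
  then have "B * (q ^ 2 - q - T * q + T ^ 2) \<le> T * g"
    by (simp add: g_def X_def power2_eq_square algebra_simps)
  moreover have "B * (T * e) \<le> B * (q ^ 2 - q - T * q + T ^ 2)"
    using e(2) B1 by (intro mult_left_mono) auto
  ultimately have "T * (B * e) \<le> T * g" by (simp add: mult.left_commute)
  then have Be: "B * e \<le> g" using TB B1 by simp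
  have "0 \<le> B * e" using B1 e(1) by simp
  \<comment> \<open>The factor \<open>B ^ 2\<close> lets \<open>e\<close> occur only as
    \<open>B * e\<close>, which can be replaced by \<open>g\<close>.\<close>
  have "B ^ 2 * (B * X) \<le> B ^ 2 * (e * (e + 1))"
  proof (intro mult_left_mono)
    have "B * X \<le> T * X" using TB X0 by simp
    then show "B * X \<le> e * (e + 1)" using e(3) by (simp add: X_def)
  qed simp
  also have "\<dots> = (B * e) * (B * e + B)" by (simp add: power2_eq_square algebra_simps)
  also have "\<dots> \<le> g * (g + B)" using Be \<open>0 \<le> B * e\<close> B1 by (intro mult_mono) auto
  finally have "B ^ 3 * X \<le> g * (g + B)" by (simp add: power2_eq_square power3_eq_cube mult.assoc)
  moreover have "0 < B ^ 3 * X - g * (g + B)"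
  proof -
    define t where "t = c - 3 / 2"
    have "0 \<le> t" and ct: "c = t + 3 / 2" using c by (simp_all add: t_def)
    have "B ^ 3 * X - g * (g + B) = 25029 / 512 + 93789 / 256 * t ^ 1 + 37137 / 32 * t ^ 2 + 903485 / 432 * t ^ 3 + 3084539 / 1296 * t ^ 4 + 386005 / 216 * t ^ 5 + 48143 / 54 * t ^ 6 + 287 / 1 * t ^ 7 + 109 / 2 * t ^ 8 + 127 / 27 * t ^ 9"
      unfolding B g_def X_def q ct by (simp add: field_simps eval_nat_numeral)
    also have "\<dots> > 0" using \<open>0 \<le> t\<close> by (intro add_nonneg_pos add_pos_nonneg) auto
    finally show ?thesis .
  qed
  ultimately show False by simp
qed

section \<open>The bounds for each order \<open>q\<close>\<close>

theorem theorem6p4: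
  fixes q :: nat and P :: "'a set" and \<B> S :: "'a set set"
  assumes "unital q P \<B>"
    and "maximal_ekr_set \<B> S"
  shows "(5 \<le> q \<longrightarrow>
            (card S = q ^ 2 \<and> point_pencil P \<B> S) \<or>
            real (card S) \<le> real q ^ 2 - real q + root 3 (real q ^ 2) - 2 / 3 * root 3 (real q) + 1) \<and>
         (q = 4 \<longrightarrow> (card S = 16 \<and> point_pencil P \<B> S) \<or> card S \<le> 13) \<and>
         (q = 3 \<longrightarrow> (card S = 9 \<and> point_pencil P \<B> S) \<or> card S \<le> 8)"
proof (cases "point_pencil P \<B> S")
  case True
  then have "card S = q ^ 2" using card_point_pencil[OF assms(1)] by (auto simp: point_pencil_def)
  then show ?thesis using True by auto
next
  case False
  define T where "T = int (card S) - (int q ^ 2 - int q)"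
  consider (neg) "T \<le> -1" | (top) "T * (int q * (int q - 1)) \<le> int q * (int q + 1)"
    | (mid) e where "T \<le> int q" "0 \<le> e" "T * e \<le> int q ^ 2 - int q - T * int q + T ^ 2"
      "T * (int q * (int q - 1)) \<le> e * (e + 1)"
    using unital_ekr_excess[OF assms False] unfolding T_def by blast
  note cases = this
  \<comment> \<open>Here \<open>q^2 - q = 6\<close>, so this is the bound 8. The second alternative
    reads \<open>6 * T \<le> 12\<close>; in the third, \<open>T = 3\<close> would need
    \<open>18 \<le> e * (e + 1)\<close> with \<open>e \<le> 2\<close>.\<close>
  have 3: "T \<le> 2" if "q = 3"
    using cases
  proof cases
    case mid
    show ?thesis
    proof (rule ccontr)
      assume "\<not> T \<le> 2"
      then have "T = 3" using mid(1) that by simp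
      then have "e \<le> 2" using mid that by simp
      then have "e * (e + 1) \<le> 2 * 3" using mid(2) by (intro mult_mono) auto
      then show False using mid(4) \<open>T = 3\<close> that by simp
    qed
  qed (use that in simp_all)
  \<comment> \<open>Here \<open>q^2 - q = 12\<close>. The second alternative reads
    \<open>12 * T \<le> 20\<close>; in the third, \<open>T \<ge> 2\<close> gives
    \<open>e \<le> 4\<close>, but \<open>e * (e + 1)\<close> would have to reach 24.\<close>
  have 4: "T \<le> 1" if "q = 4"
    using cases
  proof cases
    case mid
    show ?thesis
    proof (rule ccontr)
      assume T: "\<not> T \<le> 1"
      then consider "T = 2" | "T = 3" | "T = 4" using mid(1) \<open>q = 4\<close> by fastforce
      then have "e \<le> 4" using mid(3) that by cases auto
      then have "e * (e + 1) \<le> 4 * 5" using mid(2) by (intro mult_mono) auto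
      then show False using mid(4) T that by simp
    qed
  qed (use that in simp_all)
  have 5: "real_of_int T \<le> root 3 (real q ^ 2) - 2 / 3 * root 3 (real q) + 1" if q: "5 \<le> q"
  proof -
    define c where "c = root 3 (real q)"
    have q3: "real q = c ^ 3" by (simp add: c_def)
    \<comment> \<open>The cube of \<open>3 / 2\<close> is \<open>27 / 8\<close>, which is below
      5.\<close>
    have "root 3 ((3 / 2) ^ 3) \<le> c" unfolding c_def using q
      by (subst real_root_le_iff) (auto simp: power3_eq_cube)
    then have c: "3 / 2 \<le> c" by (subst (asm) real_root_power_cancel) auto
    have B: "root 3 (real q ^ 2) = c ^ 2" by (simp add: c_def real_root_power)
    have "0 \<le> (c - 3 / 2) * c" using c by (intro mult_nonneg_nonneg) auto
    then have B1: "1 \<le> c ^ 2 - 2 / 3 * c + 1" using c by (simp add: power2_eq_square algebra_simps)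
    have "real_of_int T \<le> c ^ 2 - 2 / 3 * c + 1"
      using cases
    proof cases
      case neg
      then show ?thesis using B1 by linarith
    next
      case top
      \<comment> \<open>For \<open>T \<ge> 2\<close> the inequality would give
        \<open>2 * (q - 1) \<le> q + 1\<close>, that is \<open>q \<le> 3\<close>.\<close>
      have "T \<le> 1"
      proof (rule ccontr)
        assume "\<not> T \<le> 1"
        then have "2 * (int q * (int q - 1)) \<le> T * (int q * (int q - 1))"
          using q by (intro mult_right_mono) auto
        then have "int q * (2 * (int q - 1)) \<le> int q * (int q + 1)" using top by (simp add: algebra_simps)
        then show False using q by simp
      qed
      then show ?thesis using B1 by linarith
    next
      case mid
      show ?thesis
      proof (rule excess_le_root_bound[OF c q3 refl])
        show "real_of_int T \<le> real q" "0 \<le> real_of_int e" using mid(1,2) by linarith+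
        have "real_of_int (T * e) \<le> real_of_int (int q ^ 2 - int q - T * int q + T ^ 2)"
          using mid(3) by (simp only: of_int_le_iff)
        then show "real_of_int T * real_of_int e \<le> (real q)\<^sup>2 - real q - real_of_int T * real q + (real_of_int T)\<^sup>2"
          by simp
        have "real_of_int (T * (int q * (int q - 1))) \<le> real_of_int (e * (e + 1))"
          using mid(4) by (simp only: of_int_le_iff)
        then show "real_of_int T * (real q * (real q - 1)) \<le> real_of_int e * (real_of_int e + 1)"
          by simp
      qed
    qed
    then show ?thesis by (simp add: B c_def)
  qed
  have s: "int (card S) = int q ^ 2 - int q + T" by (simp add: T_def)
  then have "real_of_int (int (card S)) = real_of_int (int q ^ 2 - int q + T)" by (simp only:)
  then have "real (card S) = real q ^ 2 - real q + real_of_int T" by simp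
  then show ?thesis using 3 4 5 s by auto
qed

end
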